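(* Let $k\ge 1$ and $m\ge 1$ be integers. For any tree $T$ of order $m$, every $k$-edge-connected cograph $G$ with $\delta(G)\ge k+m-[k=1]$ contains a subtree $T'\cong T$ such that $G-V(T')$ is $k$-edge-connected.
   Context: Graphs are finite, simple and undirected. The order of a graph is its number of vertices; $\delta(G)$ is the minimum degree. $[P]$ is Iverson's convention: $1$ if the statement $P$ is true and $0$ otherwise. Cographs are defined recursively: $K_1$ is a cograph; the disjoint union of cographs is a cograph; the join of cographs is a cograph, where the join $G_1+G_2$ of vertex-disjoint graphs is obtained from their disjoint union by adding all edges between $V(G_1)$ and $V(G_2)$. (Equivalently, cographs are the graphs with no induced path $P_4$ on four vertices.) The edge-connectivity $\lambda(G)$ is the minimum number of edges whose removal from $G$ results in a disconnected graph or a trivial graph (a graph of order 1); in particular $\lambda(K_1)=0$. $G$ is $k$-edge-connected if $\lambda(G)\ge k$, with the additional convention that $K_1$ is regarded as 1-edge-connected. For a proper subset $S\subsetneq V(G)$, $G-S$ is the graph obtained by deleting all vertices of $S$. A subtree of $G$ is a (not necessarily induced) subgraph that is a tree. *)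

theory Defs
  imports Main
begin

type_synonym 'a ugraph = "'a set \<times> 'a set set"

abbreviation uverts :: "'a ugraph \<Rightarrow> 'a set" where "uverts G \<equiv> fst G"
abbreviation uedges :: "'a ugraph \<Rightarrow> 'a set set" where "uedges G \<equiv> snd G"

definition simple_graph :: "'a ugraph \<Rightarrow> bool" where
  "simple_graph G \<longleftrightarrow>
     finite (uverts G) \<and> uverts G \<noteq> {} \<and> (\<forall>e\<in>uedges G. e \<subseteq> uverts G \<and> card e = 2)"

definition order_graph :: "'a ugraph \<Rightarrow> nat" where
  "order_graph G = card (uverts G)"

definition neighbours :: "'a ugraph \<Rightarrow> 'a \<Rightarrow> 'a set" where
  "neighbours G v = {u \<in> uverts G. {u, v} \<in> uedges G}"

definition vdegree :: "'a ugraph \<Rightarrow> 'a \<Rightarrow> nat" where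
  "vdegree G v = card (neighbours G v)"

definition min_degree :: "'a ugraph \<Rightarrow> nat" where
  "min_degree G = Min (vdegree G ` uverts G)"

definition subgraph_of :: "'a ugraph \<Rightarrow> 'a ugraph \<Rightarrow> bool" where
  "subgraph_of H G \<longleftrightarrow> uverts H \<subseteq> uverts G \<and> uedges H \<subseteq> uedges G"

definition graph_iso :: "'a ugraph \<Rightarrow> 'b ugraph \<Rightarrow> bool" where
  "graph_iso G H \<longleftrightarrow>
     (\<exists>f. bij_betw f (uverts G) (uverts H) \<and> uedges H = (\<lambda>e. f ` e) ` uedges G)"

definition delete_vertices :: "'a ugraph \<Rightarrow> 'a set \<Rightarrow> 'a ugraph" where
  "delete_vertices G S = (uverts G - S, {e \<in> uedges G. e \<inter> S = {}})"

definition delete_edges :: "'a ugraph \<Rightarrow> 'a set set \<Rightarrow> 'a ugraph" where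
  "delete_edges G F = (uverts G, uedges G - F)"

(* The graph without vertices does not count as connected. *)
definition connected_graph :: "'a ugraph \<Rightarrow> bool" where
  "connected_graph G \<longleftrightarrow>
     uverts G \<noteq> {} \<and>
     (\<forall>u\<in>uverts G. \<forall>v\<in>uverts G. (u, v) \<in> {(x, y). {x, y} \<in> uedges G}\<^sup>*)"

definition is_cycle :: "'a ugraph \<Rightarrow> 'a list \<Rightarrow> bool" where
  "is_cycle G p \<longleftrightarrow>
     3 \<le> length p \<and> distinct p \<and>
     (\<forall>i < length p. {p ! i, p ! (Suc i mod length p)} \<in> uedges G)"

definition is_tree :: "'a ugraph \<Rightarrow> bool" where
  "is_tree T \<longleftrightarrow> simple_graph T \<and> connected_graph T \<and> (\<nexists>p. is_cycle T p)"

definition subtree_of :: "'a ugraph \<Rightarrow> 'a ugraph \<Rightarrow> bool" where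
  "subtree_of T G \<longleftrightarrow> subgraph_of T G \<and> is_tree T"

definition graph_union :: "'a ugraph \<Rightarrow> 'a ugraph \<Rightarrow> 'a ugraph" where
  "graph_union G H = (uverts G \<union> uverts H, uedges G \<union> uedges H)"

definition graph_join :: "'a ugraph \<Rightarrow> 'a ugraph \<Rightarrow> 'a ugraph" where
  "graph_join G H =
     (uverts G \<union> uverts H,
      uedges G \<union> uedges H \<union> {{u, v} | u v. u \<in> uverts G \<and> v \<in> uverts H})"

inductive cograph :: "'a ugraph \<Rightarrow> bool" where
  single: "cograph ({v}, {})"
| union: "cograph G \<Longrightarrow> cograph H \<Longrightarrow> uverts G \<inter> uverts H = {} \<Longrightarrow> cograph (graph_union G H)"
| join: "cograph G \<Longrightarrow> cograph H \<Longrightarrow> uverts G \<inter> uverts H = {} \<Longrightarrow> cograph (graph_join G H)"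

lemma cograph_simple_graph: "cograph G \<Longrightarrow> simple_graph G"
  by (induction rule: cograph.induct)
     (fastforce simp: simple_graph_def graph_union_def graph_join_def card_2_iff)+

definition disconnecting_edges :: "'a ugraph \<Rightarrow> 'a set set \<Rightarrow> bool" where
  "disconnecting_edges G F \<longleftrightarrow>
     F \<subseteq> uedges G \<and>
     (\<not> connected_graph (delete_edges G F) \<or> order_graph (delete_edges G F) = 1)"

definition edge_connectivity :: "'a ugraph \<Rightarrow> nat" where
  "edge_connectivity G = (LEAST n. \<exists>F. disconnecting_edges G F \<and> card F = n)"

text \<open>The minimum is over a nonempty set: deleting all edges always qualifies.\<close>

lemma disconnecting_all_edges: "simple_graph G \<Longrightarrow> disconnecting_edges G (uedges G)"
proof -
  assume G: "simple_graph G"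
  have "order_graph G = 1" if c: "connected_graph (uverts G, {})"
  proof -
    have "u = v" if "u \<in> uverts G" "v \<in> uverts G" for u v
      using c that by (auto simp: connected_graph_def)
    with G have "is_singleton (uverts G)"
      by (auto simp: simple_graph_def intro: is_singletonI')
    then show ?thesis
      by (simp add: order_graph_def is_singleton_altdef)
  qed
  then show ?thesis
    by (auto simp: disconnecting_edges_def delete_edges_def order_graph_def)
qed

lemma edge_connectivity_trivial: "order_graph G = 1 \<Longrightarrow> edge_connectivity G = 0"
  unfolding edge_connectivity_def
  by (rule Least_eq_0, rule exI[of _ "{}"])
     (simp add: disconnecting_edges_def delete_edges_def order_graph_def)

text \<open>By convention, \<open>K\<^sub>1\<close> is 1-edge-connected although its edge-connectivity is 0.\<close>

definition k_edge_connected :: "nat \<Rightarrow> 'a ugraph \<Rightarrow> bool" where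
  "k_edge_connected k G \<longleftrightarrow> k \<le> edge_connectivity G \<or> (k = 1 \<and> order_graph G = 1)"

end

theory Submission
  imports Defs
begin

text \<open>
  A connected cograph with at least two vertices is a join of two nonempty parts \<open>A\<close> and \<open>B\<close>.
  Fix \<open>x \<in> A\<close> and \<open>y \<in> B\<close> and embed all but the last vertex of the tree greedily into the
  graph without \<open>x\<close> and \<open>y\<close>. The last vertex then has at least two free candidates, one of which
  leaves a remainder that meets both \<open>A\<close> and \<open>B\<close> or is a single vertex. Such a remainder has
  diameter at most two, and (Plesnik) in a graph of diameter at most two the edge-connectivity
  equals the minimum degree, which has dropped by at most \<open>m\<close>;
  for \<open>k = 1\<close> connectedness of the remainder already suffices.
\<close>

section \<open>Edge-connectivity of graphs of diameter two\<close>

lemma finite_uedges: "simple_graph G \<Longrightarrow> finite (uedges G)"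
  by (rule finite_subset[of _ "Pow (uverts G)"]) (auto simp: simple_graph_def)

text \<open>Charge each neighbour \<open>w\<close> of \<open>u\<close> to an edge of the cut: the
  edge \<open>uw\<close> itself if \<open>w\<close> lies outside \<open>S\<close>, and otherwise
  some edge from \<open>w\<close> out of \<open>S\<close>. The end of the charged edge inside
  \<open>S\<close> is \<open>u\<close> in the first case and \<open>w\<close> in the second, so no
  edge is charged twice.\<close>

lemma edge_cut_card_ge_degree:
  assumes "simple_graph H" "finite F" "u \<in> S"
    and out: "\<And>w. w \<in> S \<Longrightarrow> \<exists>z\<in>uverts H - S. {w, z} \<in> uedges H"
    and cut: "\<And>w z. w \<in> S \<Longrightarrow> z \<in> uverts H - S \<Longrightarrow> {w, z} \<in> uedges H \<Longrightarrow> {w, z} \<in> F"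
  shows "vdegree H u \<le> card F"
proof -
  obtain g where g: "\<And>w. w \<in> S \<Longrightarrow> g w \<in> uverts H - S \<and> {w, g w} \<in> uedges H"
    using out by metis
  define h where "h = (\<lambda>w. if w \<in> S then {w, g w} else {u, w})"
  have ne: "u \<notin> neighbours H u"
    using assms(1) by (auto simp: neighbours_def simple_graph_def)
  have "inj_on h (neighbours H u)"
  proof (rule inj_onI)
    fix a b assume ab: "a \<in> neighbours H u" "b \<in> neighbours H u" "h a = h b"
    then have "a \<noteq> u" "b \<noteq> u" using ne by auto
    with ab(3) g[of a] g[of b] \<open>u \<in> S\<close> show "a = b"
      by (auto simp: h_def doubleton_eq_iff split: if_splits)
  qed
  moreover have "h ` neighbours H u \<subseteq> F"
  proof (rule image_subsetI)
    fix w assume "w \<in> neighbours H u"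
    then have "w \<in> uverts H" "{u, w} \<in> uedges H"
      by (auto simp: neighbours_def insert_commute)
    then show "h w \<in> F" using g[of w] cut[of w "g w"] cut[of u w] \<open>u \<in> S\<close> by (auto simp: h_def)
  qed
  ultimately show ?thesis
    unfolding vdegree_def by (metis card_inj_on_le assms(2))
qed

text \<open>If both sides of a cut had a vertex without neighbours across, these two vertices would
  be at distance at least three. So on one side every vertex has a neighbour across, and the
  counting lemma applies to that side.\<close>

lemma edge_connectivity_diameter_two:
  assumes H: "simple_graph H" and nontrivial: "order_graph H \<noteq> 1"
    and diam: "\<And>u v. u \<in> uverts H \<Longrightarrow> v \<in> uverts H \<Longrightarrow> u \<noteq> v \<Longrightarrow>
      {u, v} \<in> uedges H \<or> (\<exists>w\<in>uverts H. {u, w} \<in> uedges H \<and> {w, v} \<in> uedges H)"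
    and deg: "\<And>v. v \<in> uverts H \<Longrightarrow> k \<le> vdegree H v"
  shows "k \<le> edge_connectivity H"
proof -
  have "k \<le> card F" if F: "disconnecting_edges H F" for F
  proof -
    let ?E = "{(x, y). {x, y} \<in> uedges H - F}"
    have sub: "F \<subseteq> uedges H" and fin: "finite F"
      using F finite_uedges[OF H] by (auto simp: disconnecting_edges_def intro: finite_subset)
    have ne: "uverts H \<noteq> {}" using H by (simp add: simple_graph_def)
    have "\<not> connected_graph (delete_edges H F)"
      using F nontrivial by (auto simp: disconnecting_edges_def delete_edges_def order_graph_def)
    then obtain a b where ab: "a \<in> uverts H" "b \<in> uverts H" "(a, b) \<notin> ?E\<^sup>*"
      using ne by (auto simp: connected_graph_def delete_edges_def)
    \<comment> \<open>The vertices still reachable from \<open>a\<close> once \<open>F\<close> is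
      removed; every edge of \<open>H\<close> leaving this set must belong to
      \<open>F\<close>.\<close>
    define S where "S = {v \<in> uverts H. (a, v) \<in> ?E\<^sup>*}"
    have S: "a \<in> S" "b \<in> uverts H - S" "S \<subseteq> uverts H" using ab by (auto simp: S_def)
    have cut: "{w, z} \<in> F" if "w \<in> S" "z \<in> uverts H - S" "{w, z} \<in> uedges H" for w z
    proof (rule ccontr)
      assume "{w, z} \<notin> F"
      with that have "(a, z) \<in> ?E\<^sup>*"
        by (auto simp: S_def intro: rtrancl_into_rtrancl)
      with that show False by (auto simp: S_def)
    qed
    show ?thesis
    proof (cases "\<forall>w\<in>S. \<exists>z\<in>uverts H - S. {w, z} \<in> uedges H")
      case True
      then have "vdegree H a \<le> card F"
        using edge_cut_card_ge_degree[OF H fin S(1)] cut by blast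
      with deg[OF ab(1)] show ?thesis by simp
    next
      case False
      then obtain u where u: "u \<in> S" "\<And>z. z \<in> uverts H - S \<Longrightarrow> {u, z} \<notin> uedges H"
        by blast
      \<comment> \<open>A vertex \<open>w\<close> outside \<open>S\<close> is not adjacent to
        \<open>u\<close>, so they have a common neighbour. As a neighbour of \<open>u\<close> it
        lies in \<open>S\<close>, so now the complement of \<open>S\<close> is the good
        side.\<close>
      have "\<exists>z\<in>uverts H - (uverts H - S). {w, z} \<in> uedges H" if w: "w \<in> uverts H - S" for w
      proof -
        have "u \<in> uverts H" "w \<in> uverts H" "u \<noteq> w" using u w S by auto
        from diam[OF this] u(2) w obtain v
          where "v \<in> uverts H" "{u, v} \<in> uedges H" "{v, w} \<in> uedges H" by auto
        moreover from this u(2) have "v \<in> S" by blast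
        ultimately show ?thesis by (auto simp: insert_commute)
      qed
      moreover have "{w, z} \<in> F"
        if "w \<in> uverts H - S" "z \<in> uverts H - (uverts H - S)" "{w, z} \<in> uedges H" for w z
        using cut[of z w] that by (auto simp: insert_commute)
      ultimately have "vdegree H b \<le> card F"
        using edge_cut_card_ge_degree[OF H fin S(2)] by blast
      with deg[OF ab(2)] show ?thesis by simp
    qed
  qed
  moreover have "\<exists>F. disconnecting_edges H F \<and> card F = edge_connectivity H"
    unfolding edge_connectivity_def
    by (rule LeastI_ex) (use disconnecting_all_edges[OF H] in blast)
  ultimately show ?thesis by metis
qed

section \<open>Growing trees vertex by vertex\<close>

text \<open>Connectivity via the reflexive transitive closure forgets the route. Closing a route up
  to a cycle needs an explicit repetition-free vertex list that stays inside
  \<open>W\<close>.\<close>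

definition path_linked :: "'a ugraph \<Rightarrow> 'a set \<Rightarrow> bool" where
  "path_linked G W \<longleftrightarrow> (\<forall>a\<in>W. \<forall>b\<in>W. \<exists>p. p \<noteq> [] \<and> hd p = a \<and> last p = b \<and> distinct p \<and>
     set p \<subseteq> W \<and> successively (\<lambda>x y. {x, y} \<in> uedges G) p)"

lemma path_linked_singleton: "path_linked G {v}"
  unfolding path_linked_def by (auto intro!: exI[of _ "[v]"])

lemma path_linked_insert:
  assumes W: "path_linked G W" and u: "u \<in> W" "v \<notin> W" "{u, v} \<in> uedges G"
  shows "path_linked G (insert v W)"
  unfolding path_linked_def
proof (intro ballI)
  let ?Q = "\<lambda>W a b p. p \<noteq> [] \<and> hd p = a \<and> last p = b \<and> distinct p \<and>
     set p \<subseteq> W \<and> successively (\<lambda>x y. {x, y} \<in> uedges G) p"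
  have old: "\<exists>p. ?Q W a b p" if "a \<in> W" "b \<in> W" for a b
    using W that unfolding path_linked_def by blast
  fix a b assume ab: "a \<in> insert v W" "b \<in> insert v W"
  consider "a = v" "b = v" | "a = v" "b \<in> W" | "a \<in> W" "b = v" | "a \<in> W" "b \<in> W"
    using ab by blast
  then show "\<exists>p. ?Q (insert v W) a b p"
  proof cases
    case 1
    then show ?thesis by (intro exI[of _ "[v]"]) auto
  next
    case 2
    obtain p where "?Q W u b p" using old[OF u(1) 2(2)] by blast
    with u 2 show ?thesis
      by (intro exI[of _ "v # p"]) (auto simp: successively_Cons insert_commute)
  next
    case 3
    obtain p where "?Q W a u p" using old[OF 3(1) u(1)] by blast
    with u 3 show ?thesis
      by (intro exI[of _ "p @ [v]"]) (auto simp: successively_append_iff)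
  next
    case 4
    then show ?thesis using old[of a b] by blast
  qed
qed

text \<open>If \<open>a\<close> and \<open>b\<close> were distinct, a path from \<open>a\<close> to
  \<open>b\<close> inside \<open>W\<close> would close up through \<open>v\<close> to a
  cycle.\<close>

lemma acyclic_unique_neighbour:
  assumes "\<nexists>p. is_cycle G p" and W: "path_linked G W"
    and "v \<notin> W" "a \<in> W" "b \<in> W" "{a, v} \<in> uedges G" "{b, v} \<in> uedges G"
  shows "a = b"
proof (rule ccontr)
  assume "a \<noteq> b"
  obtain p where p: "p \<noteq> []" "hd p = a" "last p = b" "distinct p" "set p \<subseteq> W"
      "successively (\<lambda>x y. {x, y} \<in> uedges G) p"
    using W assms unfolding path_linked_def by blast
  have len: "2 \<le> length p"
    using p \<open>a \<noteq> b\<close> by (cases p; cases "tl p") auto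
  have "is_cycle G (v # p)"
    unfolding is_cycle_def
  proof (intro conjI allI impI)
    show "distinct (v # p)" using p assms(3) by auto
  next
    fix i assume i: "i < length (v # p)"
    show "{(v # p) ! i, (v # p) ! (Suc i mod length (v # p))} \<in> uedges G"
    proof (cases "i = length p")
      case True
      then have "(v # p) ! i = b" using p by (simp add: last_conv_nth nth_Cons')
      then show ?thesis using True assms by simp
    next
      case False
      then have "Suc i mod length (v # p) = Suc i" using i by simp
      moreover have "successively (\<lambda>x y. {x, y} \<in> uedges G) (v # p)"
        using p assms(6) by (auto simp: successively_Cons insert_commute)
      ultimately show ?thesis
        using False i successively_conv_nth[of "\<lambda>x y. {x, y} \<in> uedges G" "v # p"] by auto
    qed
  qed (use len in simp)
  with assms(1) show False by blast
qed

lemma connected_boundary_edge: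
  assumes "connected_graph G" "simple_graph G" "W \<subseteq> uverts G" "W \<noteq> {}" "W \<noteq> uverts G"
  obtains u v where "u \<in> W" "v \<in> uverts G - W" "{u, v} \<in> uedges G"
proof -
  obtain a b where ab: "a \<in> W" "b \<in> uverts G - W" using assms(3-5) by blast
  then have "(a, b) \<in> {(x, y). {x, y} \<in> uedges G}\<^sup>*"
    using assms by (auto simp: connected_graph_def)
  then have "b \<in> W \<or> (\<exists>u\<in>W. \<exists>v\<in>uverts G - W. {u, v} \<in> uedges G)"
  proof (induction rule: rtrancl_induct)
    case base
    with ab show ?case by simp
  next
    case (step y z)
    moreover have "z \<in> uverts G" using step(2) assms(2) by (auto simp: simple_graph_def)
    ultimately show ?case by auto
  qed
  with ab that show thesis by blast
qed

text \<open>A tree arises from a single vertex by adding leaves. In the \<open>grow\<close> case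
  \<open>u\<close> is the only neighbour of \<open>v\<close> in \<open>W\<close>, so a greedy
  embedding meets just one adjacency constraint per new vertex.\<close>

lemma tree_grow_induct [consumes 1, case_names single grow]:
  assumes T: "is_tree T"
    and single: "\<And>r. r \<in> uverts T \<Longrightarrow> P {r}"
    and grow: "\<And>W u v. P W \<Longrightarrow> W \<subseteq> uverts T \<Longrightarrow> u \<in> W \<Longrightarrow> v \<in> uverts T - W \<Longrightarrow>
      {u, v} \<in> uedges T \<Longrightarrow> (\<And>w. w \<in> W \<Longrightarrow> {w, v} \<in> uedges T \<Longrightarrow> w = u) \<Longrightarrow> P (insert v W)"
  shows "P (uverts T)"
proof -
  have simple: "simple_graph T" and conn: "connected_graph T"
    and acyclic: "\<nexists>p. is_cycle T p" using T by (auto simp: is_tree_def)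
  have fin: "finite (uverts T)" using simple by (simp add: simple_graph_def)
  \<comment> \<open>\<open>path_linked\<close> is carried along with \<open>P\<close> because it is
    what makes the neighbour of the next vertex unique.\<close>
  have "\<exists>W. W \<subseteq> uverts T \<and> card W = Suc n \<and> path_linked T W \<and> P W" if "Suc n \<le> card (uverts T)" for n
    using that
  proof (induction n)
    case 0
    obtain r where "r \<in> uverts T" using simple by (auto simp: simple_graph_def)
    then show ?case
      using single path_linked_singleton[of T] by (intro exI[of _ "{r}"]) auto
  next
    case (Suc n)
    then obtain W where W: "W \<subseteq> uverts T" "card W = Suc n" "path_linked T W" "P W" by auto
    then have "W \<noteq> {}" "W \<noteq> uverts T" using Suc.prems by auto
    then obtain u v where uv: "u \<in> W" "v \<in> uverts T - W" "{u, v} \<in> uedges T"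
      using connected_boundary_edge[OF conn simple W(1)] by blast
    have "w = u" if "w \<in> W" "{w, v} \<in> uedges T" for w
      using acyclic_unique_neighbour[OF acyclic W(3)] that uv by blast
    then have "P (insert v W)" using grow W uv by blast
    moreover have "card (insert v W) = Suc (Suc n)"
      using W uv fin by (simp add: finite_subset)
    ultimately show ?case
      using path_linked_insert[OF W(3)] W(1) uv by (intro exI[of _ "insert v W"]) auto
  qed
  from this[of "card (uverts T) - 1"] obtain W
    where "W \<subseteq> uverts T" "card W = card (uverts T)" "P W"
    using simple fin by (auto simp: simple_graph_def card_gt_0_iff Suc_le_eq)
  then show ?thesis using card_subset_eq[OF fin] by metis
qed

section \<open>Embedding a tree into a join\<close>

text \<open>A stage of the greedy embedding. Edges are preserved but not non-edges, since the copy
  of the tree need not be induced.\<close>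

definition graph_embedding :: "'b ugraph \<Rightarrow> 'b set \<Rightarrow> 'a ugraph \<Rightarrow> ('b \<Rightarrow> 'a) \<Rightarrow> bool" where
  "graph_embedding T W G f \<longleftrightarrow> inj_on f W \<and> f ` W \<subseteq> uverts G \<and>
     (\<forall>u\<in>W. \<forall>v\<in>W. {u, v} \<in> uedges T \<longrightarrow> {f u, f v} \<in> uedges G)"

lemma graph_embedding_singleton:
  "simple_graph T \<Longrightarrow> z \<in> uverts G \<Longrightarrow> graph_embedding T {r} G (\<lambda>_. z)"
  by (auto simp: graph_embedding_def simple_graph_def)

lemma graph_embedding_extend:
  assumes "graph_embedding T W G f" "simple_graph T" "v \<notin> W"
    and "\<And>w. w \<in> W \<Longrightarrow> {w, v} \<in> uedges T \<Longrightarrow> w = u"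
    and "z \<in> neighbours G (f u)" "z \<notin> f ` W"
  shows "graph_embedding T (insert v W) G (f(v := z))"
proof -
  have loop: "{v, v} \<notin> uedges T" using assms(2) by (auto simp: simple_graph_def)
  have upd: "(f(v := z)) ` W = f ` W" using assms(3) by auto
  show ?thesis
    using assms loop unfolding graph_embedding_def upd
    by (auto simp: neighbours_def insert_commute inj_on_def)
qed

text \<open>\<open>R\<close> is what remains before the last tree vertex is placed, on
  \<open>z1\<close> or \<open>z2\<close>. If \<open>R\<close> is just \<open>{x, y}\<close>, a
  single vertex survives. Otherwise a third vertex \<open>w\<close> is a spare for its own side, so
  only the chosen vertex of the other side needs protection, and \<open>z1\<close> or
  \<open>z2\<close> differs from it.\<close>

lemma join_remainder_choice:
  assumes "finite R" "R \<subseteq> A \<union> B" "A \<inter> B = {}" "A \<inter> R \<noteq> {}" "B \<inter> R \<noteq> {}"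
    and "z1 \<in> R" "z2 \<in> R" "z1 \<noteq> z2"
  shows "\<exists>z\<in>{z1, z2}. A \<inter> (R - {z}) \<noteq> {} \<and> B \<inter> (R - {z}) \<noteq> {} \<or> card (R - {z}) = 1"
proof -
  obtain x y where xy: "x \<in> A \<inter> R" "y \<in> B \<inter> R" using assms by blast
  show ?thesis
  proof (cases "R = {x, y}")
    case True
    then have "card (R - {z1}) = 1" using xy assms by auto
    then show ?thesis by blast
  next
    case False
    then obtain w where "w \<in> R" "w \<noteq> x" "w \<noteq> y" using xy by blast
    obtain z where z: "z \<in> {z1, z2}" "z \<noteq> (if w \<in> A then y else x)" using assms(8) by auto
    show ?thesis
    proof (rule bexI[OF _ z(1)], rule disjI1)
      show "A \<inter> (R - {z}) \<noteq> {} \<and> B \<inter> (R - {z}) \<noteq> {}"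
        using xy \<open>w \<in> R\<close> \<open>w \<noteq> x\<close> \<open>w \<noteq> y\<close> z(2) assms(2) by (cases "w \<in> A") auto
    qed
  qed
qed

text \<open>Meant for \<open>N\<close> the neighbourhood of \<open>p\<close> and \<open>X\<close>
  the occupied vertices. As \<open>p\<close> itself is occupied but outside \<open>N\<close>, at
  most \<open>card X - 1\<close> elements of \<open>N\<close> are occupied; this saving of one
  provides the second candidate.\<close>

lemma two_free_neighbours:
  assumes "finite X" "Suc (card X) \<le> card N" "p \<in> X" "p \<notin> N"
  obtains z1 z2 where "z1 \<in> N - X" "z2 \<in> N - X" "z1 \<noteq> z2"
proof -
  have "N - (X - {p}) = N - X" using assms by blast
  then have "card N - card (X - {p}) \<le> card (N - X)"
    using diff_card_le_card_Diff[of "X - {p}" N] assms(1) by simp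
  moreover have "card (X - {p}) + 1 = card X"
    using assms by (metis Suc_eq_plus1 card_Suc_Diff1)
  ultimately have "2 \<le> card (N - X)" using assms(2) by linarith
  then obtain Z where "Z \<subseteq> N - X" "card Z = 2" by (metis obtain_subset_with_card_n)
  then show thesis using that by (auto simp: card_2_iff)
qed

text \<open>One vertex on each side is kept free until the last tree vertex is placed, when two
  candidates let \<open>join_remainder_choice\<close> decide. Adjacency between \<open>A\<close> and
  \<open>B\<close> enters only later, in the study of the remainder.\<close>

lemma tree_embedding_join:
  assumes T: "is_tree T" and G: "simple_graph G"
    and V: "uverts G = A \<union> B" "A \<inter> B = {}" "A \<noteq> {}" "B \<noteq> {}"
    and deg: "\<And>v. v \<in> uverts G \<Longrightarrow> card (uverts T) \<le> vdegree G v"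
  obtains f where "graph_embedding T (uverts T) G f"
    and "A - f ` uverts T \<noteq> {} \<and> B - f ` uverts T \<noteq> {} \<or> card (uverts G - f ` uverts T) = 1"
proof -
  have Ts: "simple_graph T" using T by (simp add: is_tree_def)
  have finT: "finite (uverts T)" and finG: "finite (uverts G)"
    using Ts G by (auto simp: simple_graph_def)
  obtain x y where xy: "x \<in> A" "y \<in> B" using V by blast
  \<comment> \<open>While the tree is incomplete, \<open>x\<close> and \<open>y\<close> are
    reserved; for the complete tree the condition turns into the desired property of the remainder.
    One predicate covers both, so that the induction delivers the latter.\<close>
  define allowed where "allowed W X \<longleftrightarrow>
    (if W = uverts T then A - X \<noteq> {} \<and> B - X \<noteq> {} \<or> card (uverts G - X) = 1
     else x \<notin> X \<and> y \<notin> X)" for W X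
  have irrefl: "v \<notin> neighbours G v" for v
    using G by (auto simp: neighbours_def simple_graph_def)
  have "\<exists>f. graph_embedding T (uverts T) G f \<and> allowed (uverts T) (f ` uverts T)"
    using T
  proof (induction rule: tree_grow_induct)
    case (single r)
    have "\<exists>z\<in>uverts G. allowed {r} {z}"
    proof (cases "{r} = uverts T")
      case True
      \<comment> \<open>For a tree of order one the root is already the last vertex, and
        \<open>x\<close> and \<open>y\<close> themselves serve as the two candidates.\<close>
      have "\<exists>z\<in>{x, y}. A \<inter> (uverts G - {z}) \<noteq> {} \<and> B \<inter> (uverts G - {z}) \<noteq> {} \<or> card (uverts G - {z}) = 1"
        by (rule join_remainder_choice[OF finG]) (use V xy in auto)
      then obtain z where z: "z \<in> {x, y}"
        "A \<inter> (uverts G - {z}) \<noteq> {} \<and> B \<inter> (uverts G - {z}) \<noteq> {} \<or> card (uverts G - {z}) = 1"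
        by blast
      moreover have "A \<inter> (uverts G - {z}) = A - {z}" "B \<inter> (uverts G - {z}) = B - {z}"
        using V by auto
      moreover have "z \<in> uverts G" using z(1) xy V(1) by blast
      ultimately show ?thesis using True by (auto simp: allowed_def)
    next
      case False
      \<comment> \<open>Some vertex other than \<open>x\<close> and \<open>y\<close> is wanted:
        \<open>x\<close> has at least two neighbours, none of them \<open>x\<close>, so one of them
        also differs from \<open>y\<close>.\<close>
      with single have "{r} \<subset> uverts T" by blast
      then have "2 \<le> card (uverts T)"
        using psubset_card_mono[OF finT, of "{r}"] by simp
      then have "2 \<le> card (neighbours G x)"
        using deg[of x] xy V by (auto simp: vdegree_def)
      then have "\<not> neighbours G x \<subseteq> {y}"
        using card_mono[of "{y}" "neighbours G x"] by auto
      then obtain z where "z \<in> neighbours G x" "z \<noteq> y" by blast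
      moreover have "z \<noteq> x" using calculation irrefl by blast
      ultimately show ?thesis using False by (auto simp: allowed_def neighbours_def)
    qed
    then obtain z where z: "z \<in> uverts G" "allowed {r} {z}" by blast
    then show ?case
      using graph_embedding_singleton[OF Ts z(1), of r] by (intro exI[of _ "\<lambda>_. z"]) simp
  next
    case (grow W u v)
    note uv = \<open>u \<in> W\<close> \<open>v \<in> uverts T - W\<close>
    have "W \<noteq> uverts T" using uv by blast
    with grow.IH obtain f where emb: "graph_embedding T W G f" and avoid: "x \<notin> f ` W" "y \<notin> f ` W"
      by (auto simp: allowed_def)
    let ?N = "neighbours G (f u)" and ?R = "uverts G - f ` W"
    have finW: "finite W" by (rule finite_subset[OF \<open>W \<subseteq> uverts T\<close> finT])
    have fu: "f u \<in> uverts G" "f u \<in> f ` W"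
      using emb uv by (auto simp: graph_embedding_def)
    have cardW: "card (f ` W) = card W"
      using emb by (simp add: graph_embedding_def card_image)
    have cN: "card (insert v W) \<le> card ?N"
      using deg[OF fu(1)] card_mono[OF finT, of "insert v W"] uv \<open>W \<subseteq> uverts T\<close> by (auto simp: vdegree_def)
    have "\<exists>z\<in>?N - f ` W. allowed (insert v W) (insert z (f ` W))"
    proof (cases "insert v W = uverts T")
      case True
      have "Suc (card (f ` W)) \<le> card ?N" using cN cardW uv finW by simp
      then obtain z1 z2 where z: "z1 \<in> ?N - f ` W" "z2 \<in> ?N - f ` W" "z1 \<noteq> z2"
        using two_free_neighbours[of "f ` W" ?N "f u"] finW fu irrefl by blast
      have "\<exists>z\<in>{z1, z2}. A \<inter> (?R - {z}) \<noteq> {} \<and> B \<inter> (?R - {z}) \<noteq> {} \<or> card (?R - {z}) = 1"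
        by (rule join_remainder_choice) (use V xy avoid z finG in \<open>auto simp: neighbours_def\<close>)
      moreover have "A \<inter> (?R - {z}) = A - insert z (f ` W)" "B \<inter> (?R - {z}) = B - insert z (f ` W)"
        "?R - {z} = uverts G - insert z (f ` W)" for z using V by auto
      ultimately have "\<exists>z\<in>{z1, z2}. allowed (insert v W) (insert z (f ` W))"
        using True by (simp add: allowed_def)
      then show ?thesis using z by blast
    next
      case False
      have "insert v W \<subset> uverts T" using False uv \<open>W \<subseteq> uverts T\<close> by blast
      then have "card (insert v W) < card (uverts T)" by (rule psubset_card_mono[OF finT])
      \<comment> \<open>At least two tree vertices are unplaced, so \<open>f u\<close> has at least
        \<open>card W + 2\<close> neighbours. The forbidden ones lie among the other images and
        \<open>x\<close>, \<open>y\<close>, at most \<open>card W - 1 + 2\<close> vertices in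
        all.\<close>
      then have "Suc (Suc (card (f ` W))) \<le> card ?N"
        using deg[OF fu(1)] uv finW cardW by (simp add: vdegree_def)
      moreover have "card ((f ` W - {f u}) \<union> {x, y}) \<le> Suc (card (f ` W))"
      proof -
        have "card ((f ` W - {f u}) \<union> {x, y}) \<le> card (f ` W - {f u}) + card {x, y}"
          by (rule card_Un_le)
        moreover have "card {x, y} \<le> 2" by (simp add: card_insert_if)
        moreover have "Suc (card (f ` W - {f u})) = card (f ` W)"
          using finW fu(2) by (intro card_Suc_Diff1) auto
        ultimately show ?thesis by linarith
      qed
      ultimately have "\<not> ?N \<subseteq> (f ` W - {f u}) \<union> {x, y}"
        using card_mono[of "(f ` W - {f u}) \<union> {x, y}" ?N] finW by auto
      then obtain z where "z \<in> ?N" "z \<notin> f ` W - {f u}" "z \<noteq> x" "z \<noteq> y" by blast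
      then show ?thesis
        using False avoid irrefl[of "f u"] by (intro bexI[of _ z]) (auto simp: allowed_def)
    qed
    then obtain z where z: "z \<in> ?N" "z \<notin> f ` W" "allowed (insert v W) (insert z (f ` W))"
      by blast
    have "(f(v := z)) ` insert v W = insert z (f ` W)" using uv by auto
    moreover have "graph_embedding T (insert v W) G (f(v := z))"
      by (rule graph_embedding_extend[OF emb Ts _ _ z(1,2)]) (use uv grow.hyps in blast)+
    ultimately show ?case using z(3) by metis
  qed
  then show thesis using that unfolding allowed_def by (metis (full_types))
qed

section \<open>Copies of trees\<close>

lemma is_tree_image:
  assumes T: "is_tree T" and f: "inj_on f (uverts T)"
  shows "is_tree (f ` uverts T, (`) f ` uedges T)"
proof -
  let ?T = "(f ` uverts T, (`) f ` uedges T)"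
  have simple: "simple_graph T" and conn: "connected_graph T"
    and acyclic: "\<nexists>p. is_cycle T p" using T by (auto simp: is_tree_def)
  have sub: "e \<subseteq> uverts T" if "e \<in> uedges T" for e
    using that simple by (auto simp: simple_graph_def)
  have "card (f ` e) = 2" if "e \<in> uedges T" for e
    using that simple inj_on_subset[OF f sub[OF that]] by (auto simp: simple_graph_def card_image)
  then have "simple_graph ?T"
    using simple sub by (fastforce simp: simple_graph_def)
  moreover have "connected_graph ?T"
  proof -
    have "(f a, f b) \<in> {(x, y). {x, y} \<in> uedges ?T}\<^sup>*"
      if "(a, b) \<in> {(x, y). {x, y} \<in> uedges T}\<^sup>*" for a b
      using that
    proof (induction rule: rtrancl_induct)
      case (step y z)
      then have "{f y, f z} \<in> uedges ?T" by (auto intro: rev_image_eqI)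
      with step(3) show ?case by (auto intro: rtrancl_into_rtrancl)
    qed simp
    with conn show ?thesis by (auto simp: connected_graph_def)
  qed
  moreover have "\<not> is_cycle ?T p" for p
  proof
    assume p: "is_cycle ?T p"
    let ?g = "inv_into (uverts T) f"
    have pull: "{?g a, ?g b} \<in> uedges T" if ab: "{a, b} \<in> uedges ?T" for a b
    proof -
      obtain e where e: "e \<in> uedges T" "f ` e = {a, b}" using ab by auto
      then have "?g ` {a, b} = e"
        using inv_into_image_cancel[OF f sub[OF e(1)]] by metis
      with e show ?thesis by simp
    qed
    \<comment> \<open>\<open>is_cycle\<close> speaks of edges only, so membership of the cycle's
      vertices in the image is read off their edges. It makes \<open>?g\<close> injective on the
      cycle, which thus pulls back to a cycle of \<open>T\<close>.\<close>
    have "p ! i \<in> f ` uverts T" if "i < length p" for i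
    proof -
      have "{p ! i, p ! (Suc i mod length p)} \<in> uedges ?T" using p that by (auto simp: is_cycle_def)
      then obtain e where "e \<in> uedges T" "{p ! i, p ! (Suc i mod length p)} = f ` e" by auto
      with sub[of e] show ?thesis by blast
    qed
    then have "set p \<subseteq> f ` uverts T" by (auto simp: in_set_conv_nth)
    then have "inj_on ?g (set p)" by (rule inj_on_inv_into)
    moreover have "{map ?g p ! i, map ?g p ! (Suc i mod length p)} \<in> uedges T"
      if "i < length p" for i
    proof -
      have "Suc i mod length p < length p" using that by (intro mod_less_divisor) linarith
      with pull[of "p ! i" "p ! (Suc i mod length p)"] p that show ?thesis
        by (simp add: is_cycle_def)
    qed
    ultimately have "is_cycle T (map ?g p)"
      using p unfolding is_cycle_def by (simp add: distinct_map)
    with acyclic show False by blast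
  qed
  ultimately show ?thesis by (simp add: is_tree_def)
qed

lemma graph_iso_image:
  assumes "simple_graph T" and f: "inj_on f (uverts T)"
  shows "graph_iso (f ` uverts T, (`) f ` uedges T) T"
proof -
  have "inv_into (uverts T) f ` f ` e = e" if "e \<in> uedges T" for e
    using inv_into_image_cancel[OF f] that assms(1) by (auto simp: simple_graph_def)
  then have "(`) (inv_into (uverts T) f) ` (`) f ` uedges T = uedges T"
    by (force simp: image_image)
  then show ?thesis
    unfolding graph_iso_def
    using bij_betw_inv_into[OF inj_on_imp_bij_betw[OF f]]
    by (intro exI[of _ "inv_into (uverts T) f"]) simp
qed

lemma graph_embedding_edges:
  assumes "simple_graph T" "graph_embedding T (uverts T) G f"
  shows "(`) f ` uedges T \<subseteq> uedges G"
proof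
  fix e assume "e \<in> (`) f ` uedges T"
  then obtain d where d: "d \<in> uedges T" "e = f ` d" by auto
  then have "card d = 2" using assms(1) by (simp add: simple_graph_def)
  then obtain a b where "d = {a, b}" by (auto simp: card_2_iff)
  with d assms show "e \<in> uedges G" by (auto simp: graph_embedding_def simple_graph_def)
qed

section \<open>Cographs\<close>

text \<open>Look at the last step of the construction. It cannot be a disjoint union: connectedness
  would give an edge leaving \<open>G1\<close>, but every edge lies inside \<open>G1\<close> or
  inside \<open>G2\<close>.\<close>

lemma connected_cograph_cases:
  assumes "cograph G" "connected_graph G"
  obtains v where "G = ({v}, {})"
  | A B where "uverts G = A \<union> B" "A \<inter> B = {}" "A \<noteq> {}" "B \<noteq> {}"
      "\<And>a b. a \<in> A \<Longrightarrow> b \<in> B \<Longrightarrow> {a, b} \<in> uedges G"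
  using assms(1)
proof cases
  case (single v)
  then show ?thesis using that by blast
next
  case (union G1 G2)
  note s = cograph_simple_graph[OF union(2)] cograph_simple_graph[OF union(3)]
  obtain a b where ab: "a \<in> uverts G1" "b \<in> uverts G2"
    using s by (auto simp: simple_graph_def)
  obtain u v where "u \<in> uverts G1" "v \<in> uverts G - uverts G1" "{u, v} \<in> uedges G"
    by (rule connected_boundary_edge[OF assms(2) cograph_simple_graph[OF assms(1)], of "uverts G1"])
       (use ab union in \<open>auto simp: graph_union_def\<close>)
  moreover have "e \<subseteq> uverts G1 \<or> e \<subseteq> uverts G2" if "e \<in> uedges G" for e
    using s union that by (auto simp: simple_graph_def graph_union_def)
  ultimately show ?thesis
    using union(4) by blast
next
  case (join G1 G2)
  note s = cograph_simple_graph[OF join(2)] cograph_simple_graph[OF join(3)]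
  show ?thesis
    by (rule that(2)[of "uverts G1" "uverts G2"])
       (use s join in \<open>auto simp: simple_graph_def graph_join_def\<close>)
qed

lemma k_edge_connected_imp_connected:
  assumes "simple_graph G" "k_edge_connected k G" "1 \<le> k"
  shows "connected_graph G"
proof (cases "order_graph G = 1")
  case True
  then show ?thesis
    by (auto simp: order_graph_def connected_graph_def card_1_singleton_iff)
next
  case False
  then have k: "1 \<le> edge_connectivity G" using assms by (auto simp: k_edge_connected_def)
  show ?thesis
  proof (rule ccontr)
    assume "\<not> connected_graph G"
    then have "disconnecting_edges G {}"
      by (auto simp: disconnecting_edges_def delete_edges_def)
    then have "edge_connectivity G = 0"
      unfolding edge_connectivity_def by (intro Least_eq_0) auto
    with k show False by simp
  qed
qed

lemma min_degree_le:
  "simple_graph G \<Longrightarrow> v \<in> uverts G \<Longrightarrow> min_degree G \<le> vdegree G v"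
  by (auto simp: min_degree_def simple_graph_def intro: Min_le)

lemma vdegree_delete_vertices:
  assumes "finite S" "v \<in> uverts G" "v \<notin> S"
  shows "vdegree G v - card S \<le> vdegree (delete_vertices G S) v"
proof -
  have "neighbours (delete_vertices G S) v = neighbours G v - S"
    using assms by (auto simp: neighbours_def delete_vertices_def)
  then show ?thesis
    using diff_card_le_card_Diff[OF assms(1)] by (auto simp: vdegree_def)
qed

lemma simple_graph_delete_vertices:
  "simple_graph G \<Longrightarrow> uverts G - S \<noteq> {} \<Longrightarrow> simple_graph (delete_vertices G S)"
  by (auto simp: simple_graph_def delete_vertices_def)

theorem theorem13:
  fixes k m :: nat and T :: "'b ugraph" and G :: "'a ugraph"
  assumes "k \<ge> 1" and "m \<ge> 1"
    and "is_tree T" and "order_graph T = m"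
    and "cograph G" and "k_edge_connected k G"
    and "min_degree G \<ge> k + m - of_bool (k = 1)"
  shows "\<exists>T'. subtree_of T' G \<and> graph_iso T' T \<and>
              k_edge_connected k (delete_vertices G (uverts T'))"
proof -
  have G: "simple_graph G" by (rule cograph_simple_graph[OF assms(5)])
  have Ts: "simple_graph T" using assms(3) by (simp add: is_tree_def)
  have m: "card (uverts T) = m" using assms(4) by (simp add: order_graph_def)
  have deg: "k + m - of_bool (k = 1) \<le> vdegree G v" if "v \<in> uverts G" for v
    using min_degree_le[OF G that] assms(7) by linarith
  from assms(5) k_edge_connected_imp_connected[OF G assms(6,1)] show ?thesis
  proof (cases rule: connected_cograph_cases)
    case (1 v)
    \<comment> \<open>This case is contradictory: \<open>k + m - [k = 1]\<close> is at least 1,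
      while the only vertex has degree 0.\<close>
    then have "vdegree G v = 0" by (simp add: vdegree_def neighbours_def)
    with deg[of v] 1 assms(1,2) show ?thesis by (auto simp: of_bool_def split: if_splits)
  next
    case (2 A B)
    have "card (uverts T) \<le> vdegree G v" if "v \<in> uverts G" for v
      using deg[OF that] assms(1) m by (auto simp: of_bool_def split: if_splits)
    then obtain f where f: "graph_embedding T (uverts T) G f"
      and rest: "A - f ` uverts T \<noteq> {} \<and> B - f ` uverts T \<noteq> {} \<or> card (uverts G - f ` uverts T) = 1"
      using tree_embedding_join[OF assms(3) G 2(1-4)] by blast
    let ?S = "f ` uverts T" and ?T' = "(f ` uverts T, (`) f ` uedges T)"
    let ?H = "delete_vertices G ?S"
    have inj: "inj_on f (uverts T)" and S: "?S \<subseteq> uverts G"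
      using f by (auto simp: graph_embedding_def)
    have finS: "finite ?S" using Ts by (simp add: simple_graph_def)
    have cardS: "card ?S = m" using inj m by (simp add: card_image)
    have VH: "uverts ?H = uverts G - ?S" by (simp add: delete_vertices_def)
    have EH: "{a, b} \<in> uedges ?H" if "{a, b} \<in> uedges G" "a \<notin> ?S" "b \<notin> ?S" for a b
      using that by (auto simp: delete_vertices_def)
    have "uverts G - ?S \<noteq> {}" using rest 2 by (metis Diff_eq_empty_iff card.empty le_sup_iff zero_neq_one)
    then have H: "simple_graph ?H" by (rule simple_graph_delete_vertices[OF G])
    \<comment> \<open>Deleting \<open>m\<close> vertices costs at most \<open>m\<close> in degree.
      This leaves \<open>k\<close> for \<open>k > 1\<close>, but only the empty bound 0 for
      \<open>k = 1\<close>.\<close>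
    have degH: "k - of_bool (k = 1) \<le> vdegree ?H v" if "v \<in> uverts ?H" for v
      using vdegree_delete_vertices[OF finS, of v G] deg[of v] that assms(1)
      unfolding VH cardS by (auto simp: of_bool_def split: if_splits)
    have "k_edge_connected k ?H"
    proof (cases "order_graph ?H = 1")
      case True
      \<comment> \<open>A lone vertex has degree 0, which contradicts \<open>degH\<close> for larger
        \<open>k\<close>; for \<open>k = 1\<close> the convention on \<open>K_1\<close>
        applies.\<close>
      have "k = 1"
      proof (rule ccontr)
        assume "k \<noteq> 1"
        from True obtain v where v: "uverts ?H = {v}"
          by (auto simp: order_graph_def card_1_singleton_iff)
        then have "neighbours ?H v = {}"
          using H by (auto simp: neighbours_def simple_graph_def)
        with degH[of v] v \<open>k \<noteq> 1\<close> assms(1) show False by (simp add: vdegree_def)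
      qed
      with True show ?thesis by (simp add: k_edge_connected_def)
    next
      case False
      then have "card (uverts G - ?S) \<noteq> 1" by (simp add: order_graph_def VH)
      with rest obtain x y where xy: "x \<in> A" "x \<notin> ?S" "y \<in> B" "y \<notin> ?S" by blast
      have adj: "{a, b} \<in> uedges ?H" "{b, a} \<in> uedges ?H"
        if "a \<in> A" "a \<notin> ?S" "b \<in> B" "b \<notin> ?S" for a b
        using EH[OF 2(5)] that by (auto simp: insert_commute)
      have xyH: "x \<in> uverts ?H" "y \<in> uverts ?H" using xy 2 VH by auto
      \<comment> \<open>Vertices on opposite sides are adjacent; two on the same side share the
        surviving vertex \<open>x\<close> or \<open>y\<close> of the other side as a
        neighbour.\<close>
      have diam: "{u, v} \<in> uedges ?H \<or> (\<exists>w\<in>uverts ?H. {u, w} \<in> uedges ?H \<and> {w, v} \<in> uedges ?H)"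
        if "u \<in> uverts ?H" "v \<in> uverts ?H" for u v
      proof -
        have "u \<in> A \<or> u \<in> B" "v \<in> A \<or> v \<in> B" "u \<notin> ?S" "v \<notin> ?S" using that VH 2 by auto
        then show ?thesis using adj xy xyH by meson
      qed
      have "k \<le> vdegree ?H v" if v: "v \<in> uverts ?H" for v
      proof (cases "k = 1")
        case True
        \<comment> \<open>Here \<open>degH\<close> gives nothing, but \<open>v\<close> is adjacent
          to whichever of \<open>x\<close> and \<open>y\<close> lies on the opposite side, so its
          degree is at least 1.\<close>
        have "x \<in> neighbours ?H v \<or> y \<in> neighbours ?H v"
          using v VH 2 adj xy xyH by (auto simp: neighbours_def)
        moreover have "finite (neighbours ?H v)"
          using H by (auto simp: neighbours_def simple_graph_def)
        ultimately show ?thesis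
          using True by (auto simp: vdegree_def Suc_le_eq card_gt_0_iff)
      next
        case False
        then show ?thesis using degH[OF v] by simp
      qed
      then have "k \<le> edge_connectivity ?H"
        using edge_connectivity_diameter_two[OF H False] diam by blast
      then show ?thesis by (simp add: k_edge_connected_def)
    qed
    moreover have "subtree_of ?T' G"
      using is_tree_image[OF assms(3) inj] S graph_embedding_edges[OF Ts f]
      by (simp add: subtree_of_def subgraph_of_def)
    moreover have "graph_iso ?T' T" by (rule graph_iso_image[OF Ts inj])
    ultimately show ?thesis by (intro exI[of _ ?T']) auto
  qed
qed

end
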